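(* Let $m\ge1$ and $N\ge0$ be integers. The class of hard IQCs for the repeated ReLU with filter $\Psi_N$ includes the class of hard IQCs for repeated $[0,1]$-slope-restricted nonlinearities with filter $\Psi_N$, that is, $\mathcal{M}^{\mathrm{slope}}_N\subseteq\mathcal{M}^{\mathrm{ReLU}}_N$. More precisely, if $\{Q_i\}_{i=-N}^N\subset\mathbb{R}^{m\times m}$ satisfies the conditions (i)–(iv) in the definition of $\mathcal{M}^{\mathrm{slope}}_N$ and $M_0$ is the associated matrix, then the choice $M_1=M_2=0$, $M_3=-M_0$ is admissible in the definition of $\mathcal{M}^{\mathrm{ReLU}}_N$ and yields the same matrix $M$.
   Context: Both classes are sets of real symmetric matrices $M$ of size $2m(N+1)$, each defining an IQC $\sum_{k=0}^{T_0}r(k)^\top M r(k)\ge0$ for all $T_0\ge0$, where $r(k)=[v(k)^\top,\dots,v(k-N)^\top,w(k)^\top,\dots,w(k-N)^\top]^\top$ is the output of the FIR filter $\Psi_N$ driven by $(v,w)$ from zero initial conditions. Slope-restricted class $\mathcal{M}^{\mathrm{slope}}_N$: all matrices $$M=\begin{bmatrix} 0 & M_0^\top \\ M_0 & -(M_0+M_0^\top)\end{bmatrix},\qquad M_0=\begin{bmatrix} Q_0 & Q_1 & \cdots & Q_N \\ Q_{-1} & 0 & \cdots & 0 \\ \vdots & \vdots & & \vdots \\ Q_{-N} & 0 & \cdots & 0\end{bmatrix},$$ where $\{Q_i\}_{i=-N}^N\subset\mathbb{R}^{m\times m}$ satisfy: (i) all entries of $Q_i$, $i\ne0$, are non-positive;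 (ii) all off-diagonal entries of $Q_0$ are non-positive; (iii) all row sums of $M_{row}:=[Q_{-N}\ \cdots\ Q_{-1}\ Q_0\ Q_1\ \cdots\ Q_N]$ are non-negative; (iv) all column sums of $M_{col}:=[Q_{-N}^\top\ \cdots\ Q_{-1}^\top\ Q_0^\top\ Q_1^\top\ \cdots\ Q_N^\top]^\top$ are non-negative. ReLU class $\mathcal{M}^{\mathrm{ReLU}}_N$: all matrices $$M=\begin{bmatrix} M_1 & -M_3^\top-M_1 \\ -M_3-M_1 & M_1+M_2+M_3+M_3^\top\end{bmatrix},$$ $$M_j=\begin{bmatrix} Q^j_0 & Q^j_1 & \cdots & Q^j_N \\ Q^j_1 & 0 & \cdots & 0 \\ \vdots & \vdots & & \vdots \\ Q^j_N & 0 & \cdots & 0\end{bmatrix}\ (j=1,2),\qquad M_3=\begin{bmatrix} Q^3_0 & Q^3_1 & \cdots & Q^3_N \\ Q^3_{-1} & 0 & \cdots & 0 \\ \vdots & \vdots & & \vdots \\ Q^3_{-N} & 0 & \cdots & 0\end{bmatrix},$$ where $Q^1_i,Q^2_i$ ($0\le i\le N$) are symmetric $m\times m$ matrices with non-negative entries, $Q^3_i$ ($1\le|i|\le N$) are $m\times m$ matrices with non-negative entries, and $Q^3_0\in\mathbb{R}^{m\times m}$ is Metzler (off-diagonal entries non-negative). *)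

theory Defs
  imports "Jordan_Normal_Form.Matrix"
begin

text \<open>
  The blocks \<open>Q\<close> are families indexed by \<open>int\<close>; only the indices from \<open>-N\<close> to \<open>N\<close> are ever used.
  Matrix rows and columns are numbered from 0, so entry \<open>a\<close> of a vector made of consecutive blocks of
  length \<open>m\<close> is entry \<open>a mod m\<close> of block \<open>a div m\<close>.
\<close>

definition arrow_mat :: "nat \<Rightarrow> nat \<Rightarrow> (int \<Rightarrow> real mat) \<Rightarrow> real mat" where
  "arrow_mat m N Q = mat (m * (N + 1)) (m * (N + 1)) (\<lambda>(a, b).
     if a div m = 0 then Q (int (b div m)) $$ (a mod m, b mod m)
     else if b div m = 0 then Q (- int (a div m)) $$ (a mod m, b mod m)
     else 0)"

definition block_row :: "nat \<Rightarrow> nat \<Rightarrow> (int \<Rightarrow> real mat) \<Rightarrow> real mat" where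
  "block_row m N Q = mat m (m * (2 * N + 1))
     (\<lambda>(a, b). Q (int (b div m) - int N) $$ (a, b mod m))"

definition block_col :: "nat \<Rightarrow> nat \<Rightarrow> (int \<Rightarrow> real mat) \<Rightarrow> real mat" where
  "block_col m N Q = transpose_mat (block_row m N (\<lambda>i. transpose_mat (Q i)))"

definition nonneg_entries :: "real mat \<Rightarrow> bool" where
  "nonneg_entries A \<longleftrightarrow> (\<forall>a<dim_row A. \<forall>b<dim_col A. 0 \<le> A $$ (a, b))"

definition nonpos_entries :: "real mat \<Rightarrow> bool" where
  "nonpos_entries A \<longleftrightarrow> (\<forall>a<dim_row A. \<forall>b<dim_col A. A $$ (a, b) \<le> 0)"

definition metzler :: "real mat \<Rightarrow> bool" where
  "metzler A \<longleftrightarrow> (\<forall>a<dim_row A. \<forall>b<dim_col A. a \<noteq> b \<longrightarrow> 0 \<le> A $$ (a, b))"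

definition nonpos_off_diagonal :: "real mat \<Rightarrow> bool" where
  "nonpos_off_diagonal A \<longleftrightarrow> (\<forall>a<dim_row A. \<forall>b<dim_col A. a \<noteq> b \<longrightarrow> A $$ (a, b) \<le> 0)"

definition nonneg_row_sums :: "real mat \<Rightarrow> bool" where
  "nonneg_row_sums A \<longleftrightarrow> (\<forall>a<dim_row A. 0 \<le> (\<Sum>b<dim_col A. A $$ (a, b)))"

definition nonneg_col_sums :: "real mat \<Rightarrow> bool" where
  "nonneg_col_sums A \<longleftrightarrow> (\<forall>b<dim_col A. 0 \<le> (\<Sum>a<dim_row A. A $$ (a, b)))"

definition slope_blocks :: "nat \<Rightarrow> nat \<Rightarrow> (int \<Rightarrow> real mat) \<Rightarrow> bool" where
  "slope_blocks m N Q \<longleftrightarrow>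
     (\<forall>i\<in>{- int N..int N}. Q i \<in> carrier_mat m m) \<and>
     (\<forall>i\<in>{- int N..int N}. i \<noteq> 0 \<longrightarrow> nonpos_entries (Q i)) \<and>
     nonpos_off_diagonal (Q 0) \<and>
     nonneg_row_sums (block_row m N Q) \<and>
     nonneg_col_sums (block_col m N Q)"

definition slope_mat :: "nat \<Rightarrow> nat \<Rightarrow> real mat \<Rightarrow> real mat" where
  "slope_mat m N M0 =
     four_block_mat (0\<^sub>m (m * (N + 1)) (m * (N + 1))) (transpose_mat M0)
                    M0 (- (M0 + transpose_mat M0))"

definition slope_class :: "nat \<Rightarrow> nat \<Rightarrow> real mat set" where
  "slope_class m N = {slope_mat m N (arrow_mat m N Q) | Q. slope_blocks m N Q}"

definition relu_sym_block :: "nat \<Rightarrow> nat \<Rightarrow> real mat \<Rightarrow> bool" where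
  "relu_sym_block m N A \<longleftrightarrow>
     (\<exists>Q :: nat \<Rightarrow> real mat.
        (\<forall>i\<le>N. Q i \<in> carrier_mat m m \<and> transpose_mat (Q i) = Q i \<and> nonneg_entries (Q i)) \<and>
        A = arrow_mat m N (\<lambda>i. Q (nat \<bar>i\<bar>)))"

definition relu_metzler_block :: "nat \<Rightarrow> nat \<Rightarrow> real mat \<Rightarrow> bool" where
  "relu_metzler_block m N A \<longleftrightarrow>
     (\<exists>Q :: int \<Rightarrow> real mat.
        (\<forall>i\<in>{- int N..int N}. Q i \<in> carrier_mat m m) \<and>
        (\<forall>i\<in>{- int N..int N}. i \<noteq> 0 \<longrightarrow> nonneg_entries (Q i)) \<and>
        metzler (Q 0) \<and>
        A = arrow_mat m N Q)"

definition relu_admissible :: "nat \<Rightarrow> nat \<Rightarrow> real mat \<Rightarrow> real mat \<Rightarrow> real mat \<Rightarrow> bool" where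
  "relu_admissible m N M1 M2 M3 \<longleftrightarrow>
     relu_sym_block m N M1 \<and> relu_sym_block m N M2 \<and> relu_metzler_block m N M3"

definition relu_mat :: "real mat \<Rightarrow> real mat \<Rightarrow> real mat \<Rightarrow> real mat" where
  "relu_mat M1 M2 M3 =
     four_block_mat M1 (- transpose_mat M3 - M1)
                    (- M3 - M1) (M1 + M2 + M3 + transpose_mat M3)"

definition relu_class :: "nat \<Rightarrow> nat \<Rightarrow> real mat set" where
  "relu_class m N = {relu_mat M1 M2 M3 | M1 M2 M3. relu_admissible m N M1 M2 M3}"

text \<open>The stacked vector of \<open>u(k), \<dots>, u(k-N)\<close>, where \<open>u\<close> vanishes at negative times.\<close>

definition fir_stack :: "nat \<Rightarrow> nat \<Rightarrow> (nat \<Rightarrow> real vec) \<Rightarrow> nat \<Rightarrow> real vec" where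
  "fir_stack m N u k = vec (m * (N + 1))
     (\<lambda>a. if a div m \<le> k then u (k - a div m) $ (a mod m) else 0)"

definition fir_output ::
  "nat \<Rightarrow> nat \<Rightarrow> (nat \<Rightarrow> real vec) \<Rightarrow> (nat \<Rightarrow> real vec) \<Rightarrow> nat \<Rightarrow> real vec" where
  "fir_output m N v w k = fir_stack m N v k @\<^sub>v fir_stack m N w k"

text \<open>A hard IQC is identified with the set of signal pairs that satisfy it.\<close>

definition hard_IQC ::
  "nat \<Rightarrow> nat \<Rightarrow> real mat \<Rightarrow> ((nat \<Rightarrow> real vec) \<times> (nat \<Rightarrow> real vec)) set" where
  "hard_IQC m N M = {(v, w).
     (\<forall>k. v k \<in> carrier_vec m \<and> w k \<in> carrier_vec m) \<and>
     (\<forall>T0. 0 \<le> (\<Sum>k\<le>T0. fir_output m N v w k \<bullet> (M *\<^sub>v fir_output m N v w k)))}"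

end

theory Submission imports Defs begin

text \<open>Putting \<open>M1 = M2 = 0\<close> and \<open>M3 = - M0\<close> into the ReLU form
  leaves the blocks 0, the transpose of \<open>M0\<close>, \<open>M0\<close> itself and minus their
  sum, which is the slope form (\<open>relu_mat_zero_zero_uminus\<close>). The choice is admissible:
  the zero matrix is the arrow of zero blocks (\<open>relu_sym_block_zero\<close>), negation acts
  blockwise on arrow matrices (\<open>arrow_mat_uminus\<close>), and the sign flip turns (i) and
  (ii) into non-negativity and the Metzler property
  (\<open>relu_metzler_block_uminus_arrow_mat\<close>).\<close>

lemma arrow_mat_dims [simp]:
  "dim_row (arrow_mat m N Q) = m * (N + 1)" "dim_col (arrow_mat m N Q) = m * (N + 1)"
  by (simp_all add: arrow_mat_def)

lemma relu_sym_block_zero: "relu_sym_block m N (0\<^sub>m (m * (N + 1)) (m * (N + 1)))"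
  unfolding relu_sym_block_def
proof (intro exI conjI)
  have "a mod m < m" if "a < m * (N + 1)" for a
    using that by (cases "m = 0") auto
  \<comment> \<open>The unreduced application displays the witness, the constant family of zero
    blocks. The bound on \<open>a mod m\<close> keeps every lookup inside such a block, where its
    entries are known to be 0.\<close>
  then show "0\<^sub>m (m * (N + 1)) (m * (N + 1)) = arrow_mat m N (\<lambda>i. (\<lambda>_. 0\<^sub>m m m) (nat \<bar>i\<bar>))"
    by (intro eq_matI) (auto simp: arrow_mat_def)
qed (auto simp: nonneg_entries_def)

lemma arrow_mat_uminus:
  assumes "\<And>i. i \<in> {- int N..int N} \<Longrightarrow> Q i \<in> carrier_mat m m"
  shows "- arrow_mat m N Q = arrow_mat m N (\<lambda>i. - Q i)"
proof (rule eq_matI)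
  fix a b assume "a < dim_row (arrow_mat m N (\<lambda>i. - Q i))" "b < dim_col (arrow_mat m N (\<lambda>i. - Q i))"
  then have ab: "a < m * (N + 1)" "b < m * (N + 1)"
    by auto
  \<comment> \<open>Negation can be pulled out of an entry only within the dimensions of the block.
    So the block index must lie between \<open>-N\<close> and \<open>N\<close>, where the size of
    \<open>Q\<close> is known, and the inner indices below \<open>m\<close>.\<close>
  then have "a div m < N + 1" "b div m < N + 1"
    by (metis less_mult_imp_div_less mult.commute)+
  moreover have "a mod m < m" "b mod m < m"
    using ab by (cases "m = 0"; simp)+
  moreover from calculation have "Q (int (b div m)) \<in> carrier_mat m m" "Q (- int (a div m)) \<in> carrier_mat m m"
    by (auto intro!: assms)
  ultimately show "(- arrow_mat m N Q) $$ (a, b) = arrow_mat m N (\<lambda>i. - Q i) $$ (a, b)"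
    using ab by (simp add: arrow_mat_def)
qed simp_all

lemma relu_metzler_block_uminus_arrow_mat:
  assumes "slope_blocks m N Q"
  shows "relu_metzler_block m N (- arrow_mat m N Q)"
  unfolding relu_metzler_block_def
proof (intro exI conjI)
  show "- arrow_mat m N Q = arrow_mat m N (\<lambda>i. - Q i)"
    using assms by (intro arrow_mat_uminus) (auto simp: slope_blocks_def)
qed (use assms in \<open>auto simp: slope_blocks_def nonneg_entries_def nonpos_entries_def metzler_def
    nonpos_off_diagonal_def\<close>)

lemma relu_mat_zero_zero_uminus:
  fixes M0 :: "real mat"
  assumes M0: "M0 \<in> carrier_mat (m * (N + 1)) (m * (N + 1))"
  defines "Z \<equiv> 0\<^sub>m (m * (N + 1)) (m * (N + 1))"
  shows "relu_mat Z Z (- M0) = slope_mat m N M0"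
proof -
  \<comment> \<open>Sums and differences take their size from the second operand, so
    \<open>Z\<close> is neutral only because \<open>M0\<close> has the same size.\<close>
  have "- transpose_mat (- M0) - Z = transpose_mat M0" "- (- M0) - Z = M0"
    "Z + Z + - M0 + transpose_mat (- M0) = - (M0 + transpose_mat M0)"
    unfolding Z_def using M0 by (auto intro!: eq_matI)
  then show ?thesis
    by (simp add: relu_mat_def slope_mat_def Z_def)
qed

theorem mainTheorem3:
  fixes m N :: nat
  assumes "m \<ge> 1"
  shows "hard_IQC m N ` slope_class m N \<subseteq> hard_IQC m N ` relu_class m N \<and>
    slope_class m N \<subseteq> relu_class m N \<and>
    (\<forall>Q. slope_blocks m N Q \<longrightarrow>
       (let M0 = arrow_mat m N Q; Z = 0\<^sub>m (m * (N + 1)) (m * (N + 1)) in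
          relu_admissible m N Z Z (- M0) \<and>
          relu_mat Z Z (- M0) = slope_mat m N M0))"
proof -
  let ?Z = "0\<^sub>m (m * (N + 1)) (m * (N + 1)) :: real mat"
  have adm: "relu_admissible m N ?Z ?Z (- arrow_mat m N Q)" if "slope_blocks m N Q" for Q
    unfolding relu_admissible_def
    by (intro conjI relu_sym_block_zero relu_metzler_block_uminus_arrow_mat that)
  have eq: "relu_mat ?Z ?Z (- arrow_mat m N Q) = slope_mat m N (arrow_mat m N Q)" for Q
    by (intro relu_mat_zero_zero_uminus carrier_matI arrow_mat_dims)
  have "slope_class m N \<subseteq> relu_class m N"
  proof
    fix M assume "M \<in> slope_class m N"
    then obtain Q where Q: "slope_blocks m N Q" and "M = slope_mat m N (arrow_mat m N Q)"
      unfolding slope_class_def by auto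
    then have "M = relu_mat ?Z ?Z (- arrow_mat m N Q)"
      by (simp only: eq)
    with adm[OF Q] show "M \<in> relu_class m N"
      unfolding relu_class_def mem_Collect_eq by (intro exI conjI)
  qed
  \<comment> \<open>The inclusion of the sets of IQCs is the image of the matrix inclusion under
    \<open>hard_IQC m N\<close>; the trajectories themselves need no analysis.\<close>
  then show ?thesis
    unfolding Let_def by (intro conjI allI impI image_mono adm eq)
qed

end
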